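(* Let $G=(V,p,\mu)$ be a (possibly non-reversible) finite Markov chain, $B\subsetneq V$ a proper subset, $b=|B|$ and $n=|V|$. Assume that $V$ is connected to $B$. Let $\lambda_1(r),\dots,\lambda_n(r)\in\mathbb{C}$ be continuous functions of $r\in(0,\infty)$ that for each $r$ give the $n$ eigenvalues, counted with algebraic multiplicity, of the operator $\Delta_r=(1_B+r1_{B^c})\Delta$. Then the minimum $\epsilon$ of the real parts of the eigenvalues of $L_{22}$ is strictly positive, and there exists a permutation $\pi:[n]\to[n]$ such that the limits $$\lambda_{j,\infty}=\lim_{r\to\infty}\lambda_{\pi(j)}(r)\in\mathbb{C}$$ exist for all $j\in[b]$ and agree with the eigenvalues $\sigma_j$, $j\in[b]$, of the Steklov operator $T=T^B$, counted with multiplicity, and $$\liminf_{r\to\infty}\frac1r\,\mathrm{Re}\,\lambda_{\pi(j)}(r)\ \ge\ \epsilon\qquad\text{for all } j\in\{b+1,\dots,n\}.$$ In particular, the real parts of the eigenvalues $\lambda_{\pi(j)}(r)$, $j\ge b+1$, tend to infinity as $r\to\infty$.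
   Context: $[n]=\{1,\dots,n\}$. A finite Markov chain $G=(V,p,\mu)$ (in continuous time) consists of a finite set $V$ with $|V|\ge2$, transition rates $p:V\times V\to[0,\infty)$, $(x,y)\mapsto p_{xy}$, with $p_{xx}=0$ for all $x$, and an invariant probability measure $\mu:V\to(0,\infty)$, i.e. $\sum_x\mu(x)=1$ and $\sum_{x\in V}p_{xy}\mu(x)=\mu(y)\sum_{x\in V}p_{yx}$ for all $y\in V$. The Laplacian on $C(V,\mathbb{C})=\{f:V\to\mathbb{C}\}$ is $\Delta f(x)=\sum_{y\in V}p_{xy}(f(x)-f(y))$. There is a directed edge $(x,y)$ iff $p_{xy}>0$. "$V$ is connected to $B$" means that from every vertex in $V$ there is a directed path to some vertex in $B$. $B^c=V\setminus B$ and $1_A$ is the characteristic function of $A$, acting by multiplication. Enumerating the vertices of $B$ first and then those of $B^c$, write $\Delta$ as a block matrix $\begin{pmatrix}L_{11}&L_{12}\\L_{21}&L_{22}\end{pmatrix}$; thus $L_{22}$ is the $(n-b)\times(n-b)$ block indexed by $B^c$ (the Laplacian on $B^c$ with Dirichlet boundary condition). Steklov operator: if $V$ is connected to $B$, every $f\in C(B,\mathbb{C})$ has a unique harmonic extension $F\in C(V,\mathbb{C})$, i.e. $F=f$ on $B$ and $\Delta F=0$ on $B^c$. The Steklov operator $T=T^B:C(B,\mathbb{C})\to C(B,\mathbb{C})$ is $Tf(x)=\Delta F(x)$ for $x\in B$; $\sigma_1,\dots,\sigma_b$ denote its (complex) eigenvalues, counted with algebraic multiplicity. *)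

theory Defs
  imports "Jordan_Normal_Form.Spectral_Radius" "HOL-Library.Extended_Real" "HOL-Library.Cardinality"
    "HOL-Library.Indicator_Function"
begin

text \<open>The vertex set is the finite type \<open>'v\<close>. Transition rates need not be reversible with
  respect to \<open>\<mu>\<close>; the last assumption is invariance of \<open>\<mu>\<close>.\<close>

locale finite_markov_chain =
  fixes p :: "'v::finite \<Rightarrow> 'v \<Rightarrow> real" and \<mu> :: "'v \<Rightarrow> real"
  assumes two_vertices: "CARD('v) \<ge> 2"
    and rate_nonneg: "p x y \<ge> 0"
    and rate_diag: "p x x = 0"
    and measure_pos: "\<mu> x > 0"
    and measure_total: "(\<Sum>x\<in>UNIV. \<mu> x) = 1"
    and invariant: "(\<Sum>x\<in>UNIV. p x y * \<mu> x) = \<mu> y * (\<Sum>x\<in>UNIV. p y x)"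

definition laplacian :: "('v::finite \<Rightarrow> 'v \<Rightarrow> real) \<Rightarrow> ('v \<Rightarrow> complex) \<Rightarrow> 'v \<Rightarrow> complex" where
  "laplacian p f x = (\<Sum>y\<in>UNIV. complex_of_real (p x y) * (f x - f y))"

definition scaled_laplacian ::
  "('v::finite \<Rightarrow> 'v \<Rightarrow> real) \<Rightarrow> 'v set \<Rightarrow> real \<Rightarrow> ('v \<Rightarrow> complex) \<Rightarrow> 'v \<Rightarrow> complex" where
  "scaled_laplacian p B r f x =
     (indicator B x + complex_of_real r * indicator (- B) x) * laplacian p f x"

text \<open>Paths of length zero are allowed, so vertices of \<open>B\<close> are connected to \<open>B\<close>.\<close>

definition connected_to :: "('v \<Rightarrow> 'v \<Rightarrow> real) \<Rightarrow> 'v set \<Rightarrow> bool" where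
  "connected_to p B \<longleftrightarrow> (\<forall>x. \<exists>y\<in>B. (x, y) \<in> {(u, v). p u v > 0}\<^sup>*)"

text \<open>An element of \<open>C(B, \<complex>)\<close> is given by a function on all of \<open>'v\<close> of which only the
  values on \<open>B\<close> are used. The harmonic extension is unique if the chain is connected to \<open>B\<close>.\<close>

definition harmonic_extension ::
  "('v::finite \<Rightarrow> 'v \<Rightarrow> real) \<Rightarrow> 'v set \<Rightarrow> ('v \<Rightarrow> complex) \<Rightarrow> 'v \<Rightarrow> complex" where
  "harmonic_extension p B f =
     (THE F. (\<forall>x\<in>B. F x = f x) \<and> (\<forall>x\<in>- B. laplacian p F x = 0))"

definition steklov ::
  "('v::finite \<Rightarrow> 'v \<Rightarrow> real) \<Rightarrow> 'v set \<Rightarrow> ('v \<Rightarrow> complex) \<Rightarrow> 'v \<Rightarrow> complex" where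
  "steklov p B f x = laplacian p (harmonic_extension p B f) x"

text \<open>\<open>op_mat A T\<close> is the matrix with entries \<open>T 1\<^bsub>{y}\<^esub> x\<close> for \<open>x, y \<in> A\<close>, with respect to some
  enumeration of \<open>A\<close>; the characteristic polynomial does not depend on the enumeration.
  If \<open>T\<close> acts on \<open>C(A, \<complex>)\<close>, it is the matrix of \<open>T\<close> in the standard basis; if \<open>T\<close> acts
  on functions on a larger set, it is the diagonal block of that matrix indexed by \<open>A\<close>.\<close>

definition enumeration :: "'v::finite set \<Rightarrow> 'v list" where
  "enumeration A = (SOME xs. distinct xs \<and> set xs = A)"

definition op_mat :: "'v::finite set \<Rightarrow> (('v \<Rightarrow> complex) \<Rightarrow> 'v \<Rightarrow> complex) \<Rightarrow> complex mat" where
  "op_mat A T = mat (card A) (card A)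
     (\<lambda>(i, j). T (indicator {enumeration A ! j}) (enumeration A ! i))"

text \<open>Algebraic multiplicity is multiplicity as a root of the characteristic polynomial.\<close>

definition eigenvalue_mset :: "complex mat \<Rightarrow> complex multiset" where
  "eigenvalue_mset M = proots (char_poly M)"

definition dirichlet_block :: "('v::finite \<Rightarrow> 'v \<Rightarrow> real) \<Rightarrow> 'v set \<Rightarrow> complex mat" where
  "dirichlet_block p B = op_mat (- B) (laplacian p)"

end

theory Submission
  imports Defs
begin

text \<open>The eigenvalues of \<open>\<Delta>\<^sub>r\<close> live on two scales, and each scale is seen by one limit of the
  characteristic polynomial \<open>\<chi>\<^sub>r\<close>. Write \<open>\<chi>\<^sub>D\<close> and \<open>\<chi>\<^sub>T\<close> for the characteristic polynomials of the
  Dirichlet block \<open>L\<^sub>2\<^sub>2\<close> and of the Steklov operator \<open>T\<close>. As \<open>r \<longlongrightarrow> \<infinity>\<close>,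

  \<^item> \<open>\<chi>\<^sub>r(r w) / r\<^sup>n \<longlongrightarrow> w\<^sup>b \<chi>\<^sub>D(w)\<close> (\<open>char_poly_scaled_laplacian_macro_limit\<close>), and
  \<^item> \<open>\<chi>\<^sub>r(z) / r\<^bsup>n - b\<^esup> \<longlongrightarrow> \<chi>\<^sub>T(z) \<chi>\<^sub>D(0)\<close> (\<open>char_poly_scaled_laplacian_micro_limit\<close>).

  The second limit rests on a Schur complement identity (\<open>kernel_det_steklov\<close>). By the maximum
  principle (\<open>dirichlet_eigenfunction_zero\<close>) all zeros of \<open>\<chi>\<^sub>D\<close> have positive real part, so
  \<open>\<epsilon> > 0\<close> and \<open>\<chi>\<^sub>D(0) \<noteq> 0\<close>.

  Limits of polynomials become limits of zeros by \<open>continuous_roots_tendsto\<close>, which uses that the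
  zeros are parametrised continuously. Applied to \<open>\<lambda>\<^sub>j(r) / r\<close> and the first limit, it shows that
  \<open>n - b\<close> of these quotients converge to the zeros of \<open>\<chi>\<^sub>D\<close>, which gives the growth statements, while the
  other \<open>b\<close> converge to \<open>0\<close>. The linear factors of the large eigenvalues can then be divided out of the second
  limit; what is left says that \<open>\<Prod>(z - \<lambda>\<^sub>j(r))\<close>, taken over the \<open>b\<close> remaining indices, tends to \<open>\<chi>\<^sub>T(z)\<close>. A
  second application of \<open>continuous_roots_tendsto\<close> gives the convergence to the Steklov eigenvalues.\<close>

section \<open>Zeros of convergent monic polynomials\<close>

text \<open>The values at sufficiently many points determine the coefficients by interpolation. Splitting off
  one point \<open>a\<close> by synthetic division, \<open>R(z) = (z - a) S(z) + R(a)\<close>, avoids explicit interpolation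
  formulas: \<open>S\<close> has smaller degree and tends to \<open>0\<close> at all remaining points. This is why \<open>Z\<close> is an
  arbitrary infinite set: it loses a point in each step.\<close>

lemma coeffs_tendsto_0_of_poly_tendsto_0:
  fixes R :: "'b \<Rightarrow> complex poly"
  assumes "infinite Z" and "\<And>r. degree (R r) \<le> d"
    and "\<And>z. z \<in> Z \<Longrightarrow> ((\<lambda>r. poly (R r) z) \<longlongrightarrow> 0) F"
  shows "((\<lambda>r. coeff (R r) k) \<longlongrightarrow> 0) F"
  using assms
proof (induction d arbitrary: R Z k)
  case 0
  obtain z where z: "z \<in> Z" using \<open>infinite Z\<close> by fastforce
  have R: "R r = [:coeff (R r) 0:]" for r
    using 0(2)[of r] by (metis degree_eq_zeroE coeff_pCons_0 le_zero_eq)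
  have "poly (R r) z = coeff (R r) 0" for r by (subst R) simp
  then have "((\<lambda>r. coeff (R r) 0) \<longlongrightarrow> 0) F" using 0(3)[OF z] by simp
  moreover have "coeff (R r) k = 0" if "k \<noteq> 0" for r
    using 0(2)[of r] that by (intro coeff_eq_0) simp
  ultimately show ?case by (cases "k = 0") simp_all
next
  case (Suc d)
  obtain a where a: "a \<in> Z" using \<open>infinite Z\<close> by fastforce
  define S where "S r = synthetic_div (R r) a" for r
  have split: "R r = [:- a, 1:] * S r + [:poly (R r) a:]" for r
    unfolding S_def by (rule synthetic_div_correct'[symmetric])
  have S: "((\<lambda>r. coeff (S r) k) \<longlongrightarrow> 0) F" for k
  proof (rule Suc.IH[of "Z - {a}"])
    show "infinite (Z - {a})" using Suc.prems(1) by simp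
    show "degree (S r) \<le> d" for r
      using Suc.prems(2)[of r] by (simp add: S_def degree_synthetic_div)
    show "((\<lambda>r. poly (S r) z) \<longlongrightarrow> 0) F" if z: "z \<in> Z - {a}" for z
    proof -
      have eq: "poly (S r) z = (poly (R r) z - poly (R r) a) / (z - a)" for r
      proof -
        have "poly (R r) z = (z - a) * poly (S r) z + poly (R r) a"
          using arg_cong[OF split[of r], of "\<lambda>p. poly p z"]
          by (simp add: algebra_simps)
        then show ?thesis using z by (simp add: field_simps)
      qed
      have "((\<lambda>r. (poly (R r) z - poly (R r) a) / (z - a)) \<longlongrightarrow> (0 - 0) / (z - a)) F"
        using z a by (intro tendsto_intros Suc.prems(3)) auto
      then show ?thesis by (simp add: eq)
    qed
  qed
  have "coeff (R r) k = coeff [:poly (R r) a:] k - a * coeff (S r) k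
      + (if k = 0 then 0 else coeff (S r) (k - 1))" for r
    using arg_cong[OF split[of r], of "\<lambda>p. coeff p k"]
    by (cases k) (simp_all add: algebra_simps)
  moreover have "((\<lambda>r. coeff [:poly (R r) a:] k - a * coeff (S r) k
      + (if k = 0 then 0 else coeff (S r) (k - 1))) \<longlongrightarrow> 0 - a * 0 + 0) F"
    using Suc.prems(3)[OF a] S by (intro tendsto_intros) (cases k, simp_all)+
  ultimately show ?case by simp
qed

lemma monic_root_norm_le:
  fixes w :: complex
  assumes "degree P = d" "coeff P d = 1" "poly P w = 0"
    and "\<And>k. k < d \<Longrightarrow> norm (coeff P k) \<le> C" "C \<ge> 0"
  shows "norm w \<le> 1 + d * C"
proof (rule ccontr)
  assume "\<not> ?thesis"
  then have w: "norm w > 1 + d * C" by simp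
  moreover have "d * C \<ge> 0" using \<open>C \<ge> 0\<close> by simp
  ultimately have w1: "norm w \<ge> 1" by linarith
  have d: "d > 0"
  proof (rule ccontr)
    assume "\<not> d > 0"
    then have "P = 1" using assms(1,2) by (metis degree_eq_zeroE coeff_pCons_0 gr_zeroI one_pCons)
    then show False using assms(3) by simp
  qed
  have "0 = (\<Sum>k\<le>d. coeff P k * w ^ k)" using assms(1,3) by (simp add: poly_altdef)
  also have "\<dots> = (\<Sum>k<d. coeff P k * w ^ k) + w ^ d"
    using assms(2) by (simp add: lessThan_Suc_atMost[symmetric])
  finally have "w ^ d = - (\<Sum>k<d. coeff P k * w ^ k)" by (simp add: eq_neg_iff_add_eq_0 add.commute)
  then have "norm w ^ d = norm (\<Sum>k<d. coeff P k * w ^ k)" by (metis norm_minus_cancel norm_power)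
  also have "\<dots> \<le> (\<Sum>k<d. C * norm w ^ (d - 1))"
    by (rule sum_norm_le)
      (use w1 assms(4,5) in \<open>auto simp: norm_mult norm_power intro!: mult_mono power_increasing\<close>)
  also have "\<dots> = (d * C) * norm w ^ (d - 1)" by simp
  also have "\<dots> < norm w * norm w ^ (d - 1)"
    using w w1 by (intro mult_strict_right_mono zero_less_power) linarith+
  also have "\<dots> = norm w ^ d" using d by (metis power_minus_mult mult.commute)
  finally show False by simp
qed

text \<open>A continuous curve that approaches the zero set of \<open>q\<close> eventually stays in a union of disjoint
  discs around the zeros. Its tail is connected, so it stays in a single disc and converges to the
  centre. Without continuity the curve could jump between zeros forever.\<close>

lemma continuous_tendsto_root:
  fixes f :: "real \<Rightarrow> complex"
  assumes cont: "continuous_on {a<..} f" and q: "q \<noteq> 0"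
    and lim: "((\<lambda>r. poly q (f r)) \<longlongrightarrow> 0) at_top"
  shows "\<exists>l. poly q l = 0 \<and> (f \<longlongrightarrow> l) at_top"
proof -
  define Z where "Z = {z. poly q z = 0}"
  have finZ: "finite Z" using q poly_roots_finite unfolding Z_def by blast
  \<comment> \<open>\<open>q\<close> is bounded below off any neighbourhood of its zero set, as each linear factor is.\<close>
  have near: "eventually (\<lambda>r. \<exists>z\<in>Z. dist z (f r) < \<delta>) at_top" if "\<delta> > 0" for \<delta>
  proof -
    obtain A where A: "q = Polynomial.smult (lead_coeff q) (\<Prod>x\<in>#A. [:-x, 1:])"
      using alg_closed_imp_factorization[OF q] by blast
    have AZ: "x \<in> Z" if "x \<in># A" for x
    proof -
      obtain A' where "A = add_mset x A'" using \<open>x \<in># A\<close> by (metis insert_DiffM)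
      then show ?thesis unfolding Z_def by (subst A) simp
    qed
    have "norm (poly (\<Prod>x\<in>#M. [:-x, 1:]) w) \<ge> \<delta> ^ size M"
      if "\<And>x. x \<in># M \<Longrightarrow> dist x w \<ge> \<delta>" for M and w :: complex
      using that
    proof (induction M)
      case (add x M)
      have "norm (w - x) \<ge> \<delta>" using add.prems[of x] by (simp add: dist_norm norm_minus_commute)
      then have "\<delta> * \<delta> ^ size M \<le> norm (w - x) * norm (poly (\<Prod>x\<in>#M. [:-x, 1:]) w)"
        using \<open>\<delta> > 0\<close> add by (intro mult_mono) auto
      moreover have "poly (\<Prod>x\<in>#add_mset x M. [:-x, 1:]) w = (w - x) * poly (\<Prod>x\<in>#M. [:-x, 1:]) w"
        by (simp add: algebra_simps)
      ultimately show ?case by (simp only: norm_mult size_add_mset power_Suc)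
    qed simp
    then have low: "norm (poly q w) \<ge> norm (lead_coeff q) * \<delta> ^ size A"
      if "\<And>x. x \<in> Z \<Longrightarrow> dist x w \<ge> \<delta>" for w
      using that AZ by (subst A) (auto simp: norm_mult intro!: mult_left_mono)
    have "norm (lead_coeff q) * \<delta> ^ size A > 0" using q \<open>\<delta> > 0\<close> by simp
    from tendstoD[OF lim this] show ?thesis
      by eventually_elim (use low in \<open>force simp: not_less\<close>)
  qed
  \<comment> \<open>Distinct zeros are at least \<open>2 \<delta>\<close> apart; the \<open>1\<close> in \<open>D\<close> covers the case of at most one zero.\<close>
  obtain \<delta> where \<delta>: "\<delta> > 0" "\<And>z z'. z \<in> Z \<Longrightarrow> z' \<in> Z \<Longrightarrow> z \<noteq> z' \<Longrightarrow> dist z z' \<ge> 2 * \<delta>"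
  proof
    define D where "D = insert 1 {dist z z' |z z'. z \<in> Z \<and> z' \<in> Z \<and> z \<noteq> z'}"
    have "D \<subseteq> insert 1 ((\<lambda>(z, z'). dist z z') ` (Z \<times> Z))" unfolding D_def by auto
    then have finD: "finite D" using finZ by (meson finite_SigmaI finite_imageI finite_insert finite_subset)
    show "Min D / 2 > 0" using finD by (auto simp: Min_gr_iff D_def)
    show "dist z z' \<ge> 2 * (Min D / 2)" if "z \<in> Z" "z' \<in> Z" "z \<noteq> z'" for z z'
      using Min_le[OF finD, of "dist z z'"] that by (auto simp: D_def)
  qed
  obtain R where R: "R > a" "\<And>r. r \<ge> R \<Longrightarrow> \<exists>z\<in>Z. dist z (f r) < \<delta>"
  proof -
    obtain R0 where "\<And>r. r \<ge> R0 \<Longrightarrow> \<exists>z\<in>Z. dist z (f r) < \<delta>"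
      using near[OF \<delta>(1)] unfolding eventually_at_top_linorder by blast
    then show ?thesis by (intro that[of "max (a + 1) R0"]) auto
  qed
  obtain l where l: "l \<in> Z" "dist l (f R) < \<delta>" using R(2)[of R] by auto
  have conn: "connected (f ` {R..})"
    using cont R(1) by (intro connected_continuous_image continuous_on_subset[OF cont]) auto
  have stay: "dist l (f r) < \<delta>" if "r \<ge> R" for r
  proof (rule ccontr)
    assume far: "\<not> dist l (f r) < \<delta>"
    define U where "U = {w. dist l w < \<delta>}"
    define V where "V = (\<Union>z\<in>Z - {l}. {w. dist z w < \<delta>})"
    have "U \<inter> V = {}"
    proof (rule ccontr)
      assume "U \<inter> V \<noteq> {}"
      then obtain z w where "z \<in> Z - {l}" "dist l w < \<delta>" "dist z w < \<delta>"
        unfolding U_def V_def by auto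
      then show False using \<delta>(2)[of l z] l(1) dist_triangle2[of l z w] by auto
    qed
    moreover have "f ` {R..} \<subseteq> U \<union> V" using R(2) unfolding U_def V_def by fastforce
    moreover have "U \<inter> f ` {R..} \<noteq> {}" using l unfolding U_def by auto
    moreover have "V \<inter> f ` {R..} \<noteq> {}"
      using R(2)[OF that] far that unfolding V_def by fastforce
    moreover have "open U" "open V"
      unfolding U_def V_def by (auto intro!: open_UN open_Collect_less continuous_intros)
    ultimately show False using connectedD[OF conn, of U V] by blast
  qed
  have "(f \<longlongrightarrow> l) at_top"
  proof (rule tendstoI)
    fix e :: real assume "e > 0"
    then have "min e \<delta> > 0" using \<delta> by simp
    from near[OF this] eventually_ge_at_top[of R]
    show "eventually (\<lambda>r. dist (f r) l < e) at_top"
    proof eventually_elim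
      case (elim r)
      then obtain z where z: "z \<in> Z" "dist z (f r) < min e \<delta>" by auto
      have "z = l"
        using \<delta>(2)[OF z(1) l(1)] z stay[OF elim(2)] dist_triangle2[of z l "f r"] by force
      then show ?case using z by (simp add: dist_commute)
    qed
  qed
  then show ?thesis using l(1) unfolding Z_def by blast
qed

text \<open>Continuous parametrisations of the zeros converge as soon as the monic polynomials do. No
  matching of zeros is needed to identify the limits with the zeros of \<open>q\<close>, counted with
  multiplicity: once each \<open>f j\<close> has some limit \<open>l j\<close>, the product \<open>\<Prod>(z - f j r)\<close> tends both to
  \<open>q(z)\<close> and to \<open>\<Prod>(z - l j)\<close>. That the \<open>f j\<close> converge follows from \<open>q(f j r) \<longlongrightarrow> 0\<close>, which holds
  because \<open>f j r\<close> is bounded and the coefficients converge.\<close>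

lemma continuous_roots_tendsto:
  fixes f :: "'i \<Rightarrow> real \<Rightarrow> complex"
  assumes J: "finite J" and cont: "\<And>j. j \<in> J \<Longrightarrow> continuous_on {a<..} (f j)"
    and q: "degree q = card J" "lead_coeff q = 1"
    and lim: "\<And>z. ((\<lambda>r. \<Prod>j\<in>J. z - f j r) \<longlongrightarrow> poly q z) at_top"
  shows "\<exists>l. (\<forall>j\<in>J. (f j \<longlongrightarrow> l j) at_top) \<and> q = (\<Prod>j\<in>J. [:- l j, 1:])"
proof -
  define d where "d = card J"
  define P where "P r = (\<Prod>j\<in>J. [:- f j r, 1:])" for r
  have polyP: "poly (P r) z = (\<Prod>j\<in>J. z - f j r)" for r z
    by (simp add: P_def poly_prod)
  have degP: "degree (P r) = d" for r
    unfolding P_def d_def by (subst degree_prod_eq_sum_degree) auto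
  have "lead_coeff (P r) = 1" for r unfolding P_def by (simp add: lead_coeff_prod)
  then have monP: "coeff (P r) d = 1" for r by (simp add: degP)
  have q0: "q \<noteq> 0" using q(2) by auto
  have "((\<lambda>r. coeff (P r - q) k) \<longlongrightarrow> 0) at_top" for k
  proof (rule coeffs_tendsto_0_of_poly_tendsto_0[of UNIV _ d])
    show "degree (P r - q) \<le> d" for r
      using degP q by (intro degree_diff_le) (auto simp: d_def)
    show "((\<lambda>r. poly (P r - q) z) \<longlongrightarrow> 0) at_top" for z
      using LIM_zero[OF lim[of z]] by (simp add: polyP)
  qed (simp add: infinite_UNIV_char_0)
  then have coeff_lim: "((\<lambda>r. coeff (P r) k) \<longlongrightarrow> coeff q k) at_top" for k
    by (simp add: LIM_zero_iff)
  have ex: "\<exists>l. poly q l = 0 \<and> (f j \<longlongrightarrow> l) at_top" if j: "j \<in> J" for j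
  proof (rule continuous_tendsto_root[OF cont[OF j] q0])
    have root: "poly (P r) (f j r) = 0" for r using j J by (auto simp: polyP)
    define C where "C = (\<Sum>k<d. norm (coeff q k) + 1)"
    have C: "norm (coeff q k) + 1 \<le> C" if "k < d" for k
      unfolding C_def using that by (intro member_le_sum) auto
    have C0: "C \<ge> 0" unfolding C_def by (intro sum_nonneg) auto
    have "eventually (\<lambda>r. \<forall>k\<in>{..<d}. norm (coeff (P r) k) \<le> C) at_top"
    proof (rule eventually_ball_finite)
      show "\<forall>k\<in>{..<d}. eventually (\<lambda>r. norm (coeff (P r) k) \<le> C) at_top"
      proof
        fix k assume "k \<in> {..<d}"
        then have "norm (coeff q k) < C" using C[of k] by auto
        then have "eventually (\<lambda>r. norm (coeff (P r) k) < C) at_top"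
          by (rule order_tendstoD(2)[OF tendsto_norm[OF coeff_lim]])
        then show "eventually (\<lambda>r. norm (coeff (P r) k) \<le> C) at_top"
          by (rule eventually_mono) simp
      qed
    qed simp
    then have bounded: "eventually (\<lambda>r. norm (f j r) \<le> 1 + d * C) at_top"
      by (rule eventually_mono) (use monic_root_norm_le[OF degP monP root] C0 in auto)
    define K where "K = 1 + d * C"
    have K: "K \<ge> 0" using C0 by (simp add: K_def)
    show "((\<lambda>r. poly q (f j r)) \<longlongrightarrow> 0) at_top"
    proof (rule tendsto_0_le)
      have "eventually (\<lambda>r. norm (poly q (f j r))
          \<le> (\<Sum>k\<le>d. norm (coeff q k - coeff (P r) k) * K ^ k)) at_top"
        using bounded
      proof eventually_elim
        case (elim r)
        have "poly q (f j r) = poly q (f j r) - poly (P r) (f j r)" using root by simp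
        also have "\<dots> = (\<Sum>k\<le>d. (coeff q k - coeff (P r) k) * f j r ^ k)"
          using degP q by (simp add: poly_altdef d_def sum_subtractf algebra_simps)
        also have "norm \<dots> \<le> (\<Sum>k\<le>d. norm (coeff q k - coeff (P r) k) * K ^ k)"
          by (rule sum_norm_le)
            (use elim in \<open>auto simp: norm_mult norm_power K_def intro!: mult_left_mono power_mono\<close>)
        finally show ?case .
      qed
      then show "eventually (\<lambda>r. norm (poly q (f j r))
          \<le> norm (\<Sum>k\<le>d. norm (coeff q k - coeff (P r) k) * K ^ k) * 1) at_top"
        by (rule eventually_mono) simp
      have "((\<lambda>r. \<Sum>k\<le>d. norm (coeff q k - coeff (P r) k) * K ^ k)
          \<longlongrightarrow> (\<Sum>k\<le>d. norm (coeff q k - coeff q k) * K ^ k)) at_top"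
        by (intro tendsto_intros coeff_lim)
      then show "((\<lambda>r. \<Sum>k\<le>d. norm (coeff q k - coeff (P r) k) * K ^ k) \<longlongrightarrow> 0) at_top"
        by simp
    qed
  qed
  then obtain l where l: "\<And>j. j \<in> J \<Longrightarrow> (f j \<longlongrightarrow> l j) at_top" by metis
  have "poly q z = poly (\<Prod>j\<in>J. [:- l j, 1:]) z" for z
  proof (rule tendsto_unique[OF _ lim])
    have "((\<lambda>r. \<Prod>j\<in>J. z - f j r) \<longlongrightarrow> (\<Prod>j\<in>J. z - l j)) at_top"
      by (intro tendsto_intros l)
    then show "((\<lambda>r. \<Prod>j\<in>J. z - f j r) \<longlongrightarrow> poly (\<Prod>j\<in>J. [:- l j, 1:]) z) at_top"
      by (simp add: poly_prod)
  qed simp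
  then have "q = (\<Prod>j\<in>J. [:- l j, 1:])" by (simp add: poly_eq_poly_eq_iff[symmetric] fun_eq_iff)
  then show ?thesis using l by blast
qed

section \<open>Determinants of kernels on finite sets\<close>

text \<open>Determinants of operators on \<open>C(A, \<complex>)\<close>, given by kernels \<open>K x y\<close> with \<open>x, y \<in> A\<close>. Working with
  kernels on vertices rather than with numbered matrix entries allows splitting \<open>A\<close> into blocks in
  whichever order is convenient, since the determinant does not depend on the enumeration.\<close>

definition kernel_mat :: "'v list \<Rightarrow> ('v \<Rightarrow> 'v \<Rightarrow> complex) \<Rightarrow> complex mat" where
  "kernel_mat xs K = mat (length xs) (length xs) (\<lambda>(i, j). K (xs ! i) (xs ! j))"

definition kernel_det :: "'v::finite set \<Rightarrow> ('v \<Rightarrow> 'v \<Rightarrow> complex) \<Rightarrow> complex" where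
  "kernel_det A K = det (kernel_mat (enumeration A) K)"

lemma kernel_mat_carrier [simp]: "kernel_mat xs K \<in> carrier_mat (length xs) (length xs)"
  by (simp add: kernel_mat_def)

lemma enumeration [simp]: "distinct (enumeration A)" "set (enumeration A) = A"
proof -
  have "\<exists>xs. distinct xs \<and> set xs = A" using finite_distinct_list[of A] by auto
  from someI_ex[OF this] show "distinct (enumeration A)" "set (enumeration A) = A"
    by (simp_all add: enumeration_def)
qed

lemma length_enumeration [simp]: "length (enumeration A) = card A"
  by (metis distinct_card enumeration)

lemma kernel_mat_enumeration_carrier [simp]:
  "kernel_mat (enumeration A) K \<in> carrier_mat (card A) (card A)"
  by (simp add: kernel_mat_def)

text \<open>Rows and columns are permuted by the same \<open>\<pi>\<close>, so the two signs cancel.\<close>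

lemma det_kernel_mat_permute:
  assumes "mset xs = mset ys"
  shows "det (kernel_mat xs K) = det (kernel_mat ys K)"
proof -
  obtain \<pi> where \<pi>: "\<pi> permutes {..<length ys}" and xs: "permute_list \<pi> ys = xs"
    using mset_eq_permutation[OF assms] by blast
  define n where "n = length ys"
  have len: "length xs = n" using xs by (auto simp: n_def)
  have p: "\<pi> permutes {0..<n}" using \<pi> by (simp add: n_def lessThan_atLeast0)
  have in_n: "\<pi> i < n" if "i < n" for i using permutes_in_image[OF p, of i] that by auto
  \<comment> \<open>Only the rows of \<open>M\<close> are in the order of \<open>ys\<close>; the columns are already in that of \<open>xs\<close>.\<close>
  define M where "M = mat n n (\<lambda>(i, j). K (ys ! i) (xs ! j))"
  have nth: "xs ! i = ys ! \<pi> i" if "i < n" for i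
    using permute_list_nth[OF \<pi>, of i] that xs by (simp add: n_def)
  have "kernel_mat xs K = mat n n (\<lambda>(i, j). M $$ (\<pi> i, j))"
    by (rule eq_matI) (auto simp: kernel_mat_def len M_def in_n nth)
  then have 1: "det (kernel_mat xs K) = signof \<pi> * det M"
    using det_permute_rows[OF _ p, of M] by (simp add: M_def)
  have "transpose_mat M = mat n n (\<lambda>(i, j). transpose_mat (kernel_mat ys K) $$ (\<pi> i, j))"
    using in_n nth by (intro eq_matI) (auto simp: M_def kernel_mat_def n_def)
  then have "det (transpose_mat M) = signof \<pi> * det (transpose_mat (kernel_mat ys K))"
    using det_permute_rows[OF _ p, of "transpose_mat (kernel_mat ys K)"] by (simp add: n_def)
  then have 2: "det M = signof \<pi> * det (kernel_mat ys K)"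
    by (subst (asm) (1 2) det_transpose[of _ n]) (simp_all add: M_def n_def)
  have "signof \<pi> * signof \<pi> = (1 :: complex)" by (simp add: sign_def)
  then show ?thesis using 1 2 by (simp add: mult.assoc[symmetric])
qed

lemma kernel_det_eq:
  assumes "distinct xs" "set xs = A"
  shows "kernel_det A K = det (kernel_mat xs K)"
  unfolding kernel_det_def
  by (rule det_kernel_mat_permute) (use assms in \<open>simp add: set_eq_iff_mset_eq_distinct[symmetric]\<close>)

lemma kernel_det_cong:
  assumes "\<And>x y. x \<in> A \<Longrightarrow> y \<in> A \<Longrightarrow> K x y = K' x y"
  shows "kernel_det A K = kernel_det A K'"
proof -
  have "kernel_mat (enumeration A) K = kernel_mat (enumeration A) K'"
    using assms nth_mem[of _ "enumeration A"] by (intro eq_matI) (auto simp: kernel_mat_def)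
  then show ?thesis by (simp add: kernel_det_def)
qed

lemma kernel_det_mult:
  "kernel_det A K * kernel_det A K' = kernel_det A (\<lambda>x y. \<Sum>k\<in>A. K x k * K' k y)"
proof -
  let ?xs = "enumeration A"
  have "(\<Sum>k\<in>A. g k) = (\<Sum>i = 0..<card A. g (?xs ! i))" for g :: "'a \<Rightarrow> complex"
    using sum.reindex_bij_betw[OF bij_betw_nth[of ?xs "{0..<card A}" A], of g]
    by (simp add: lessThan_atLeast0)
  then have "kernel_mat ?xs K * kernel_mat ?xs K' = kernel_mat ?xs (\<lambda>x y. \<Sum>k\<in>A. K x k * K' k y)"
    by (intro eq_matI) (auto simp: kernel_mat_def scalar_prod_def)
  then show ?thesis
    unfolding kernel_det_def by (metis det_mult kernel_mat_carrier)
qed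

lemma kernel_mat_append:
  "kernel_mat (xs @ ys) K = four_block_mat (kernel_mat xs K)
     (mat (length xs) (length ys) (\<lambda>(i, j). K (xs ! i) (ys ! j)))
     (mat (length ys) (length xs) (\<lambda>(i, j). K (ys ! i) (xs ! j))) (kernel_mat ys K)"
  by (rule eq_matI) (auto simp: kernel_mat_def nth_append)

lemma kernel_det_block_triangular:
  assumes "C \<inter> D = {}" and "\<And>x y. x \<in> D \<Longrightarrow> y \<in> C \<Longrightarrow> K x y = 0"
  shows "kernel_det (C \<union> D) K = kernel_det C K * kernel_det D K"
proof -
  let ?xs = "enumeration C" and ?ys = "enumeration D"
  have zero: "mat (length ?ys) (length ?xs) (\<lambda>(i, j). K (?ys ! i) (?xs ! j)) = 0\<^sub>m (length ?ys) (length ?xs)"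
    using assms(2) nth_mem[of _ ?xs] nth_mem[of _ ?ys] by (intro eq_matI) auto
  have "kernel_det (C \<union> D) K = det (kernel_mat (?xs @ ?ys) K)"
    using assms(1) by (intro kernel_det_eq) auto
  also have "\<dots> = det (kernel_mat ?xs K) * det (kernel_mat ?ys K)"
    unfolding kernel_mat_append
    by (rule det_four_block_mat_lower_left_zero[OF _ _ zero]) simp_all
  finally show ?thesis by (simp add: kernel_det_def)
qed

lemma kernel_det_expand:
  "kernel_det A K = (\<Sum>\<pi> | \<pi> permutes {0..<card A}.
     signof \<pi> * (\<Prod>i = 0..<card A. K (enumeration A ! i) (enumeration A ! \<pi> i)))"
proof -
  have "kernel_mat (enumeration A) K $$ (i, \<pi> i) = K (enumeration A ! i) (enumeration A ! \<pi> i)"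
    if "\<pi> permutes {0..<card A}" "i \<in> {0..<card A}" for \<pi> i
    using that permutes_in_image[OF that(1), of i] by (auto simp: kernel_mat_def)
  then show ?thesis unfolding kernel_det_def det_def'[OF kernel_mat_carrier] by simp
qed

lemma kernel_det_scale_rows:
  "kernel_det A (\<lambda>x y. c x * K x y) = (\<Prod>x\<in>A. c x) * kernel_det A K"
proof -
  have "(\<Prod>x\<in>A. c x) = (\<Prod>i = 0..<card A. c (enumeration A ! i))"
    using prod.reindex_bij_betw[OF bij_betw_nth[of "enumeration A" "{0..<card A}" A], of c]
    by (simp add: lessThan_atLeast0)
  then show ?thesis
    by (simp add: kernel_det_expand sum_distrib_left prod.distrib algebra_simps)
qed

lemma kernel_det_one: "kernel_det A (\<lambda>x y. if x = y then 1 else 0) = 1"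
proof -
  have "kernel_mat (enumeration A) (\<lambda>x y. if x = y then 1 else 0) = 1\<^sub>m (card A)"
    by (rule eq_matI) (auto simp: kernel_mat_def nth_eq_iff_index_eq)
  then show ?thesis by (simp add: kernel_det_def)
qed

lemma kernel_det_diagonal:
  "kernel_det A (\<lambda>x y. if x = y then c x else 0) = (\<Prod>x\<in>A. c x)"
  using kernel_det_scale_rows[of A c "\<lambda>x y. if x = y then 1 else 0"] kernel_det_one[of A]
  by (simp add: if_distrib cong: if_cong)

lemma tendsto_kernel_det:
  assumes "\<And>x y. ((\<lambda>r. K r x y) \<longlongrightarrow> K' x y) F"
  shows "((\<lambda>r. kernel_det A (K r)) \<longlongrightarrow> kernel_det A K') F"
  unfolding kernel_det_expand by (intro tendsto_intros assms)

lemma kernel_mat_mult_vec: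
  assumes "distinct xs"
  shows "kernel_mat xs K *\<^sub>v vec (length xs) (\<lambda>i. f (xs ! i))
    = vec (length xs) (\<lambda>i. \<Sum>y\<in>set xs. K (xs ! i) y * f y)"
proof -
  have "(\<Sum>k\<in>set xs. g k) = (\<Sum>i = 0..<length xs. g (xs ! i))" for g :: "'a \<Rightarrow> complex"
    using sum.reindex_bij_betw[OF bij_betw_nth[OF assms refl refl], of g]
    by (simp add: lessThan_atLeast0)
  then show ?thesis by (intro eq_vecI) (auto simp: kernel_mat_def scalar_prod_def)
qed

lemma vec_eq_of_list:
  assumes "distinct xs" "v \<in> carrier_vec (length xs)"
  obtains f where "v = vec (length xs) (\<lambda>i. f (xs ! i))"
proof
  show "v = vec (length xs) (\<lambda>i. (\<lambda>x. v $ (THE i. i < length xs \<and> xs ! i = x)) (xs ! i))"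
  proof (rule eq_vecI)
    fix i assume "i < dim_vec (vec (length xs) (\<lambda>i. (\<lambda>x. v $ (THE i. i < length xs \<and> xs ! i = x)) (xs ! i)))"
    then have i: "i < length xs" by simp
    then have "(THE j. j < length xs \<and> xs ! j = xs ! i) = i"
      using assms(1) by (intro the_equality) (auto simp: nth_eq_iff_index_eq)
    then show "v $ i = vec (length xs) (\<lambda>i. (\<lambda>x. v $ (THE i. i < length xs \<and> xs ! i = x)) (xs ! i)) $ i"
      using i by simp
  qed (use assms in auto)
qed

lemma kernel_det_eq_0D:
  assumes "kernel_det A K = 0"
  shows "\<exists>f. (\<exists>x\<in>A. f x \<noteq> 0) \<and> (\<forall>x\<in>A. (\<Sum>y\<in>A. K x y * f y) = 0)"
proof -
  let ?xs = "enumeration A"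
  obtain v where v: "v \<in> carrier_vec (length ?xs)" "v \<noteq> 0\<^sub>v (length ?xs)"
      and ker: "kernel_mat ?xs K *\<^sub>v v = 0\<^sub>v (length ?xs)"
    using assms det_0_iff_vec_prod_zero[OF kernel_mat_carrier] unfolding kernel_det_def by blast
  obtain f where f: "v = vec (length ?xs) (\<lambda>i. f (?xs ! i))"
    using vec_eq_of_list[OF _ v(1)] by auto
  have "\<exists>x\<in>A. f x \<noteq> 0"
  proof (rule ccontr)
    assume "\<not> (\<exists>x\<in>A. f x \<noteq> 0)"
    then have "v = 0\<^sub>v (length ?xs)"
      using nth_mem[of _ ?xs] by (intro eq_vecI) (auto simp: f)
    with v show False by simp
  qed
  moreover have "(\<Sum>y\<in>A. K x y * f y) = 0" if "x \<in> A" for x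
  proof -
    obtain i where i: "i < card A" "x = ?xs ! i"
      using \<open>x \<in> A\<close> in_set_conv_nth[of x ?xs] by auto
    show ?thesis
      using arg_cong[OF ker[unfolded f kernel_mat_mult_vec[OF enumeration(1)]], of "\<lambda>v. v $ i"] i
      by simp
  qed
  ultimately show ?thesis by blast
qed

lemma kernel_det_solve:
  assumes "kernel_det A K \<noteq> 0"
  shows "\<exists>f. \<forall>x\<in>A. (\<Sum>y\<in>A. K x y * f y) = g x"
proof -
  let ?xs = "enumeration A"
  let ?n = "length ?xs"
  let ?K = "kernel_mat ?xs K" and ?g = "vec ?n (\<lambda>i. g (?xs ! i))"
  obtain M where M: "M \<in> carrier_mat ?n ?n" and inv: "?K * M = 1\<^sub>m ?n"
    using det_non_zero_imp_unit[OF kernel_mat_carrier assms[unfolded kernel_det_def], of "()"]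
    by (auto simp: Units_def ring_mat_def)
  obtain f where f: "M *\<^sub>v ?g = vec ?n (\<lambda>i. f (?xs ! i))"
    using vec_eq_of_list[of ?xs "M *\<^sub>v ?g"] M by auto
  have "?K *\<^sub>v (M *\<^sub>v ?g) = (?K * M) *\<^sub>v ?g"
    by (rule assoc_mult_mat_vec[symmetric, OF kernel_mat_carrier M]) simp
  also have "\<dots> = ?g" by (simp add: inv)
  finally have sol: "?K *\<^sub>v vec ?n (\<lambda>i. f (?xs ! i)) = ?g" by (simp only: f)
  have "(\<Sum>y\<in>A. K x y * f y) = g x" if "x \<in> A" for x
  proof -
    obtain i where i: "i < card A" "x = ?xs ! i"
      using \<open>x \<in> A\<close> in_set_conv_nth[of x ?xs] by auto
    show ?thesis
      using arg_cong[OF sol[unfolded kernel_mat_mult_vec[OF enumeration(1)]], of "\<lambda>v. v $ i"] i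
      by simp
  qed
  then show ?thesis by blast
qed

lemma poly_char_poly_op_mat:
  "poly (char_poly (op_mat A T)) z
     = kernel_det A (\<lambda>x y. (if x = y then z else 0) - T (indicator {y}) x)"
proof -
  have "op_mat A T \<in> carrier_mat (card A) (card A)" by (simp add: op_mat_def)
  moreover have "- char_matrix (op_mat A T) z
      = kernel_mat (enumeration A) (\<lambda>x y. (if x = y then z else 0) - T (indicator {y}) x)"
    by (rule eq_matI) (auto simp: char_matrix_def op_mat_def kernel_mat_def nth_eq_iff_index_eq)
  ultimately show ?thesis by (simp add: char_poly_matrix kernel_det_def)
qed

section \<open>The maximum principle\<close>

definition laplacian_kernel :: "('v::finite \<Rightarrow> 'v \<Rightarrow> real) \<Rightarrow> 'v \<Rightarrow> 'v \<Rightarrow> complex" where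
  "laplacian_kernel p x y = laplacian p (indicator {y}) x"

lemma laplacian_eq_kernel_sum:
  "laplacian p f x = (\<Sum>y\<in>UNIV. laplacian_kernel p x y * f y)"
proof -
  have pick: "(\<Sum>y\<in>UNIV. indicator {y} z * f y) = f z" for z
    by (simp add: indicator_def if_distrib[of "\<lambda>c. c * _"] cong: if_cong)
  have "(\<Sum>y\<in>UNIV. laplacian_kernel p x y * f y)
      = (\<Sum>y\<in>UNIV. \<Sum>z\<in>UNIV. complex_of_real (p x z) * (indicator {y} x * f y - indicator {y} z * f y))"
    unfolding laplacian_kernel_def laplacian_def sum_distrib_right
    by (intro sum.cong refl) (simp add: algebra_simps)
  also have "\<dots> = (\<Sum>z\<in>UNIV. complex_of_real (p x z) *
      ((\<Sum>y\<in>UNIV. indicator {y} x * f y) - (\<Sum>y\<in>UNIV. indicator {y} z * f y)))"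
    by (subst sum.swap) (simp only: sum_distrib_left[symmetric] sum_subtractf)
  also have "\<dots> = laplacian p f x" by (simp only: pick laplacian_def)
  finally show ?thesis by simp
qed

lemma laplacian_diff: "laplacian p (\<lambda>x. f x - g x) x = laplacian p f x - laplacian p g x"
  by (simp add: laplacian_eq_kernel_sum right_diff_distrib sum_subtractf)

text \<open>The maximum principle for complex eigenfunctions. At a vertex \<open>u\<close> where \<open>|F|\<close> is maximal,
  the real part of \<open>cnj (F u) * \<Delta>F(u)\<close> is a sum of non-negative terms, one for each edge out of
  \<open>u\<close>. It equals \<open>Re \<zeta> |F u|\<^sup>2 \<le> 0\<close>, so all terms vanish and \<open>|F|\<close> is maximal at every
  successor of \<open>u\<close>. Following a path to \<open>B\<close>, where \<open>F = 0\<close>, gives \<open>F = 0\<close>. Besides the positivity of the real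
  parts of the Dirichlet spectrum this yields, for \<open>\<zeta> = 0\<close>, the uniqueness of harmonic extensions.\<close>

lemma dirichlet_eigenfunction_zero:
  fixes p :: "'v::finite \<Rightarrow> 'v \<Rightarrow> real"
  assumes nonneg: "\<And>x y. p x y \<ge> 0" and conn: "connected_to p B"
    and zero: "\<And>x. x \<in> B \<Longrightarrow> F x = 0"
    and eigen: "\<And>x. x \<notin> B \<Longrightarrow> laplacian p F x = \<zeta> * F x"
    and "Re \<zeta> \<le> 0"
  shows "F x = 0"
proof (rule ccontr)
  assume "F x \<noteq> 0"
  define M where "M = Max (range (\<lambda>x. norm (F x)))"
  have le: "norm (F y) \<le> M" for y unfolding M_def by (intro Max_ge) auto
  have "M > 0" using le[of x] \<open>F x \<noteq> 0\<close> zero_less_norm_iff[of "F x"] by linarith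
  have step: "norm (F y) = M" if u: "norm (F u) = M" and "p u y > 0" for u y
  proof -
    have "u \<notin> B" using zero u \<open>M > 0\<close> by force
    define t where "t v = p u v * (M\<^sup>2 - Re (cnj (F u) * F v))" for v
    have Re_le: "Re (cnj (F u) * F v) \<le> M * norm (F v)" for v
      using complex_Re_le_cmod[of "cnj (F u) * F v"] u by (simp add: norm_mult)
    have "M * norm (F v) \<le> M\<^sup>2" for v
      using le[of v] \<open>M > 0\<close> by (simp add: power2_eq_square)
    then have t: "t v \<ge> 0" for v
      unfolding t_def using nonneg Re_le[of v] by (intro mult_nonneg_nonneg) (auto intro: order_trans)
    have sq: "cnj (F u) * F u = complex_of_real (M\<^sup>2)"
      using u complex_norm_square[of "F u"] by (simp add: mult.commute)
    have "(\<Sum>v\<in>UNIV. t v) = Re (cnj (F u) * laplacian p F u)"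
    proof -
      have "cnj (F u) * laplacian p F u
          = (\<Sum>v\<in>UNIV. complex_of_real (p u v) * (cnj (F u) * F u - cnj (F u) * F v))"
        by (simp add: laplacian_def sum_distrib_left algebra_simps)
      then show ?thesis unfolding sq by (simp add: t_def)
    qed
    also have "cnj (F u) * laplacian p F u = \<zeta> * complex_of_real (M\<^sup>2)"
      using eigen[OF \<open>u \<notin> B\<close>] by (simp only: sq[symmetric] mult.left_commute)
    also have "Re \<dots> \<le> 0"
      using \<open>Re \<zeta> \<le> 0\<close> by (simp add: mult_nonpos_nonneg del: of_real_power)
    finally have "t y = 0"
      using sum_nonneg_eq_0_iff[of UNIV t] sum_nonneg[of UNIV t] t by simp
    then have "M\<^sup>2 \<le> M * norm (F y)" using \<open>p u y > 0\<close> Re_le[of y] by (simp add: t_def)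
    then have "M \<le> norm (F y)" using \<open>M > 0\<close> by (simp add: power2_eq_square)
    then show ?thesis using le[of y] by simp
  qed
  obtain m where m: "norm (F m) = M"
    using Max_in[of "range (\<lambda>x. norm (F x))"] unfolding M_def by fastforce
  obtain y where y: "y \<in> B" "(m, y) \<in> {(u, v). p u v > 0}\<^sup>*"
    using conn unfolding connected_to_def by blast
  from y(2) have "norm (F y) = M"
    by (induction rule: rtrancl_induct) (use m step in auto)
  with zero[OF y(1)] \<open>M > 0\<close> show False by simp
qed

lemma kernel_det_dirichlet_nonzero:
  fixes p :: "'v::finite \<Rightarrow> 'v \<Rightarrow> real"
  assumes nonneg: "\<And>x y. p x y \<ge> 0" and conn: "connected_to p B" and "Re z \<le> 0"
  shows "kernel_det (- B) (\<lambda>x y. (if x = y then z else 0) - laplacian_kernel p x y) \<noteq> 0"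
proof
  assume "kernel_det (- B) (\<lambda>x y. (if x = y then z else 0) - laplacian_kernel p x y) = 0"
  from kernel_det_eq_0D[OF this] obtain f x0 where x0: "x0 \<in> - B" "f x0 \<noteq> 0"
    and ker: "\<And>x. x \<in> - B \<Longrightarrow>
      (\<Sum>y\<in>- B. ((if x = y then z else 0) - laplacian_kernel p x y) * f y) = 0" by blast
  define F where "F x = (if x \<in> B then 0 else f x)" for x
  have "F x0 = 0"
  proof (rule dirichlet_eigenfunction_zero[OF nonneg conn _ _ \<open>Re z \<le> 0\<close>])
    show "laplacian p F x = z * F x" if x: "x \<notin> B" for x
    proof -
      have "laplacian p F x = (\<Sum>y\<in>- B. laplacian_kernel p x y * F y)"
        unfolding laplacian_eq_kernel_sum
        by (rule sum.mono_neutral_right) (auto simp: F_def)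
      also have "\<dots> = (\<Sum>y\<in>- B. laplacian_kernel p x y * f y)"
        by (rule sum.cong) (auto simp: F_def)
      also have "\<dots> = (\<Sum>y\<in>- B. if x = y then z * f y else 0)"
        using ker[of x] x
        by (simp add: left_diff_distrib sum_subtractf if_distrib[of "\<lambda>c. c * _"] cong: if_cong)
      finally show ?thesis using x by (simp add: F_def)
    qed
  qed (simp add: F_def)
  with x0 show False by (simp add: F_def)
qed

section \<open>Harmonic extensions and the Steklov operator\<close>

lemma harmonic_extension:
  fixes p :: "'v::finite \<Rightarrow> 'v \<Rightarrow> real"
  assumes nonneg: "\<And>x y. p x y \<ge> 0" and conn: "connected_to p B"
  shows "x \<in> B \<Longrightarrow> harmonic_extension p B f x = f x"
    and "x \<notin> B \<Longrightarrow> laplacian p (harmonic_extension p B f) x = 0"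
proof -
  let ?P = "\<lambda>F. (\<forall>x\<in>B. F x = f x) \<and> (\<forall>x\<in>- B. laplacian p F x = 0)"
  have "\<exists>!F. ?P F"
  proof (rule ex_ex1I)
    obtain g where g: "\<And>x. x \<in> - B \<Longrightarrow>
        (\<Sum>y\<in>- B. ((if x = y then 0 else 0) - laplacian_kernel p x y) * g y)
          = (\<Sum>y\<in>B. laplacian_kernel p x y * f y)"
      using kernel_det_solve[OF kernel_det_dirichlet_nonzero[OF nonneg conn, of 0]] by force
    define F where "F x = (if x \<in> B then f x else g x)" for x
    have "laplacian p F x = 0" if x: "x \<in> - B" for x
    proof -
      have "laplacian p F x = (\<Sum>y\<in>B. laplacian_kernel p x y * F y)
          + (\<Sum>y\<in>- B. laplacian_kernel p x y * F y)"
        unfolding laplacian_eq_kernel_sum by (subst sum.union_disjoint[symmetric]) auto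
      also have "\<dots> = (\<Sum>y\<in>B. laplacian_kernel p x y * f y)
          + (\<Sum>y\<in>- B. laplacian_kernel p x y * g y)"
        by (intro arg_cong2[where f = "(+)"] sum.cong) (auto simp: F_def)
      also have "\<dots> = 0" using g[OF x] by (simp add: sum_negf neg_eq_iff_add_eq_0 add.commute)
      finally show ?thesis .
    qed
    then show "\<exists>F. ?P F" by (intro exI[of _ F]) (simp add: F_def)
  next
    fix F G assume F: "?P F" and G: "?P G"
    have "F x - G x = 0" for x
      by (rule dirichlet_eigenfunction_zero[OF nonneg conn, of "\<lambda>x. F x - G x" 0])
        (use F G in \<open>auto simp: laplacian_diff\<close>)
    then show "F = G" by (intro ext) simp
  qed
  from theI'[OF this] have "?P (harmonic_extension p B f)" unfolding harmonic_extension_def .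
  then show "x \<in> B \<Longrightarrow> harmonic_extension p B f x = f x"
    and "x \<notin> B \<Longrightarrow> laplacian p (harmonic_extension p B f) x = 0" by auto
qed

text \<open>A Schur complement without inverting \<open>L\<^sub>2\<^sub>2\<close>. Let \<open>H\<close> be the lower block-triangular matrix whose
  columns for \<open>y \<in> B\<close> are the harmonic extensions of the unit vectors, and whose remaining columns are
  unit vectors; its determinant is \<open>1\<close>. By definition of the Steklov operator \<open>T\<close>, the columns
  of \<open>\<Delta> H\<close> for \<open>y \<in> B\<close> are those of \<open>T\<close> on \<open>B\<close> and vanish off \<open>B\<close>. Hence multiplication by
  \<open>H\<close> turns the matrix on the left into an upper block-triangular one with diagonal blocks
  \<open>z - T\<close> and \<open>- L\<^sub>2\<^sub>2\<close>.\<close>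

lemma kernel_det_steklov:
  fixes p :: "'v::finite \<Rightarrow> 'v \<Rightarrow> real"
  assumes nonneg: "\<And>x y. p x y \<ge> 0" and conn: "connected_to p B"
  shows "kernel_det UNIV (\<lambda>x y. (if x = y \<and> x \<in> B then z else 0) - laplacian_kernel p x y)
    = poly (char_poly (op_mat B (steklov p B))) z * poly (char_poly (dirichlet_block p B)) 0"
proof -
  note ext = harmonic_extension[OF nonneg conn]
  define K where "K x y = (if x = y \<and> x \<in> B then z else 0) - laplacian_kernel p x y" for x y
  define H where "H k y = (if y \<in> B then harmonic_extension p B (indicator {y}) k
    else if k = y then 1 else 0)" for k y
  define KH where "KH x y = (\<Sum>k\<in>UNIV. K x k * H k y)" for x y
  have UNIV1: "- B \<union> B = UNIV" and UNIV2: "B \<union> - B = UNIV" by auto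
  have "kernel_det UNIV H = kernel_det (- B) H * kernel_det B H"
    by (subst UNIV1[symmetric], rule kernel_det_block_triangular) (auto simp: H_def)
  also have "kernel_det (- B) H = kernel_det (- B) (\<lambda>x y. if x = y then 1 else 0)"
    by (rule kernel_det_cong) (auto simp: H_def)
  also have "kernel_det B H = kernel_det B (\<lambda>x y. if x = y then 1 else 0)"
    by (rule kernel_det_cong) (auto simp: H_def ext)
  finally have detH: "kernel_det UNIV H = 1" by (simp add: kernel_det_one)
  have KH_B: "KH x y = (if x \<in> B then (if x = y then z else 0) - steklov p B (indicator {y}) x else 0)"
    if y: "y \<in> B" for x y
  proof -
    let ?F = "harmonic_extension p B (indicator {y})"
    have "KH x y = (\<Sum>k\<in>UNIV. (if x = k then if x \<in> B then z * ?F k else 0 else 0)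
        - laplacian_kernel p x k * ?F k)"
      unfolding KH_def by (rule sum.cong) (auto simp: K_def H_def y left_diff_distrib)
    also have "\<dots> = (if x \<in> B then z * ?F x else 0) - laplacian p ?F x"
      by (simp add: sum_subtractf laplacian_eq_kernel_sum)
    finally show ?thesis using ext[where f = "indicator {y}"] by (auto simp: steklov_def)
  qed
  have KH_compl: "KH x y = - laplacian_kernel p x y" if "x \<notin> B" "y \<notin> B" for x y
    using that by (simp add: KH_def H_def K_def if_distrib[of "\<lambda>c. _ * c"] cong: if_cong)
  have "kernel_det UNIV K = kernel_det UNIV K * kernel_det UNIV H" by (simp add: detH)
  also have "\<dots> = kernel_det UNIV KH" by (simp add: kernel_det_mult KH_def[abs_def])
  also have "\<dots> = kernel_det B KH * kernel_det (- B) KH"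
    by (subst UNIV2[symmetric], rule kernel_det_block_triangular) (auto simp: KH_B)
  also have "kernel_det B KH = poly (char_poly (op_mat B (steklov p B))) z"
    unfolding poly_char_poly_op_mat by (rule kernel_det_cong) (auto simp: KH_B)
  also have "kernel_det (- B) KH = poly (char_poly (dirichlet_block p B)) 0"
    unfolding dirichlet_block_def poly_char_poly_op_mat
    by (rule kernel_det_cong) (auto simp: KH_compl laplacian_kernel_def)
  finally show ?thesis by (simp add: K_def[abs_def])
qed

section \<open>The two limits of the characteristic polynomial\<close>

lemma poly_char_poly_scaled_laplacian:
  "poly (char_poly (op_mat UNIV (scaled_laplacian p B r))) z
    = kernel_det UNIV (\<lambda>x y. (if x = y then z else 0)
        - (if x \<in> B then 1 else complex_of_real r) * laplacian_kernel p x y)"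
  unfolding poly_char_poly_op_mat
  by (rule kernel_det_cong) (auto simp: scaled_laplacian_def laplacian_kernel_def)

lemma one_over_of_real_tendsto_0: "((\<lambda>r. complex_of_real (1 / r)) \<longlongrightarrow> 0) at_top"
  by (rule tendsto_of_real[of _ 0, unfolded of_real_0], rule tendsto_divide_0[OF tendsto_const],
      rule filterlim_at_top_imp_at_infinity, rule filterlim_ident)

text \<open>Eigenvalues of order \<open>r\<close>: in \<open>\<Delta>\<^sub>r / r\<close> the rows of \<open>B\<close> tend to \<open>0\<close>, which leaves a block-triangular
  matrix with diagonal blocks \<open>0\<close> and \<open>L\<^sub>2\<^sub>2\<close>.\<close>

lemma char_poly_scaled_laplacian_macro_limit:
  fixes p :: "'v::finite \<Rightarrow> 'v \<Rightarrow> real"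
  shows "((\<lambda>r. poly (char_poly (op_mat UNIV (scaled_laplacian p B r))) (complex_of_real r * w)
      / complex_of_real r ^ CARD('v))
    \<longlongrightarrow> w ^ card B * poly (char_poly (dirichlet_block p B)) w) at_top"
proof -
  let ?K = "\<lambda>r x y. (if x = y then w else 0)
    - (if x \<in> B then complex_of_real (1 / r) else 1) * laplacian_kernel p x y"
  let ?L = "\<lambda>x y. (if x = y then w else 0) - (if x \<in> B then 0 else 1) * laplacian_kernel p x y"
  have UNIV1: "- B \<union> B = UNIV" by auto
  have "((\<lambda>r. kernel_det UNIV (?K r)) \<longlongrightarrow> kernel_det UNIV ?L) at_top"
    by (intro tendsto_kernel_det tendsto_intros) (use one_over_of_real_tendsto_0 in \<open>auto split: if_splits\<close>)
  also have "kernel_det UNIV ?L = kernel_det (- B) ?L * kernel_det B ?L"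
    by (subst UNIV1[symmetric], rule kernel_det_block_triangular) auto
  also have "kernel_det (- B) ?L = poly (char_poly (dirichlet_block p B)) w"
    unfolding dirichlet_block_def poly_char_poly_op_mat
    by (rule kernel_det_cong) (auto simp: laplacian_kernel_def)
  also have "kernel_det B ?L = kernel_det B (\<lambda>x y. if x = y then w else 0)"
    by (rule kernel_det_cong) auto
  also have "\<dots> = w ^ card B" by (simp add: kernel_det_diagonal)
  finally have "((\<lambda>r. kernel_det UNIV (?K r))
    \<longlongrightarrow> w ^ card B * poly (char_poly (dirichlet_block p B)) w) at_top" by (simp add: mult.commute)
  moreover have "eventually (\<lambda>r. kernel_det UNIV (?K r)
      = poly (char_poly (op_mat UNIV (scaled_laplacian p B r))) (complex_of_real r * w)
        / complex_of_real r ^ CARD('v)) at_top"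
    using eventually_gt_at_top[of 0]
  proof eventually_elim
    case (elim r)
    have "poly (char_poly (op_mat UNIV (scaled_laplacian p B r))) (complex_of_real r * w)
        = kernel_det UNIV (\<lambda>x y. complex_of_real r * ?K r x y)"
      unfolding poly_char_poly_scaled_laplacian
      by (rule kernel_det_cong) (use elim in \<open>auto simp: field_simps\<close>)
    also have "\<dots> = complex_of_real r ^ CARD('v) * kernel_det UNIV (?K r)"
      by (simp add: kernel_det_scale_rows)
    finally show ?case using elim by simp
  qed
  ultimately show ?thesis by (rule Lim_transform_eventually)
qed

text \<open>Bounded eigenvalues: dividing the rows of \<open>z - \<Delta>\<^sub>r\<close> off \<open>B\<close> by \<open>r\<close> makes \<open>z\<close> disappear from these rows
  in the limit, and what remains is the determinant of \<open>kernel_det_steklov\<close>.\<close>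

lemma char_poly_scaled_laplacian_micro_limit:
  fixes p :: "'v::finite \<Rightarrow> 'v \<Rightarrow> real"
  assumes nonneg: "\<And>x y. p x y \<ge> 0" and conn: "connected_to p B"
  shows "((\<lambda>r. poly (char_poly (op_mat UNIV (scaled_laplacian p B r))) z
      / complex_of_real r ^ card (- B))
    \<longlongrightarrow> poly (char_poly (op_mat B (steklov p B))) z
      * poly (char_poly (dirichlet_block p B)) 0) at_top"
proof -
  let ?K = "\<lambda>r x y. (if x = y then if x \<in> B then z else complex_of_real (1 / r) * z else 0)
    - laplacian_kernel p x y"
  have "((\<lambda>r. complex_of_real (1 / r) * z) \<longlongrightarrow> 0) at_top"
    by (rule tendsto_mult_left_zero[OF one_over_of_real_tendsto_0])
  then have "((\<lambda>r. if x = y then if x \<in> B then z else complex_of_real (1 / r) * z else 0)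
      \<longlongrightarrow> (if x = y \<and> x \<in> B then z else 0)) at_top" for x y
    by (cases "x = y"; cases "x \<in> B") simp_all
  then have "((\<lambda>r. kernel_det UNIV (?K r)) \<longlongrightarrow>
      kernel_det UNIV (\<lambda>x y. (if x = y \<and> x \<in> B then z else 0) - laplacian_kernel p x y)) at_top"
    by (intro tendsto_kernel_det tendsto_diff tendsto_const)
  moreover have "eventually (\<lambda>r. kernel_det UNIV (?K r)
      = poly (char_poly (op_mat UNIV (scaled_laplacian p B r))) z
        / complex_of_real r ^ card (- B)) at_top"
    using eventually_gt_at_top[of 0]
  proof eventually_elim
    case (elim r)
    have "poly (char_poly (op_mat UNIV (scaled_laplacian p B r))) z
        = kernel_det UNIV (\<lambda>x y. (if x \<in> B then 1 else complex_of_real r) * ?K r x y)"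
      unfolding poly_char_poly_scaled_laplacian
      by (rule kernel_det_cong) (use elim in \<open>auto simp: field_simps\<close>)
    also have "\<dots> = complex_of_real r ^ card (- B) * kernel_det UNIV (?K r)"
      by (simp add: kernel_det_scale_rows prod.If_cases Compl_eq)
    finally show ?case using elim by simp
  qed
  ultimately show ?thesis
    unfolding kernel_det_steklov[OF nonneg conn] by (rule Lim_transform_eventually)
qed

section \<open>Asymptotics of the eigenvalues\<close>

theorem theorem1p9:
  fixes p :: "'v::finite \<Rightarrow> 'v \<Rightarrow> real" and \<mu> :: "'v \<Rightarrow> real"
    and B :: "'v set" and b n :: nat
    and lam :: "nat \<Rightarrow> real \<Rightarrow> complex" and \<epsilon> :: real
  assumes "finite_markov_chain p \<mu>"
    and "B \<subset> UNIV" and "b = card B" and "n = CARD('v)"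
    and "connected_to p B"
    and "\<And>j. j \<in> {1..n} \<Longrightarrow> continuous_on {0<..} (lam j)"
    and "\<And>r. r > 0 \<Longrightarrow>
      {# lam j r. j \<in># mset_set {1..n} #} = eigenvalue_mset (op_mat UNIV (scaled_laplacian p B r))"
    and "\<epsilon> = Min (Re ` spectrum (dirichlet_block p B))"
  shows "\<epsilon> > 0 \<and>
    (\<exists>\<pi> l_inf. \<pi> permutes {1..n} \<and>
      (\<forall>j\<in>{1..b}. (lam (\<pi> j) \<longlongrightarrow> l_inf j) at_top) \<and>
      {# l_inf j. j \<in># mset_set {1..b} #} = eigenvalue_mset (op_mat B (steklov p B)) \<and>
      (\<forall>j\<in>{b+1..n}. Liminf at_top (\<lambda>r. ereal (1 / r * Re (lam (\<pi> j) r))) \<ge> ereal \<epsilon>) \<and>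
      (\<forall>j\<in>{b+1..n}. filterlim (\<lambda>r. Re (lam (\<pi> j) r)) at_top at_top))"
proof -
  have nonneg: "p x y \<ge> 0" for x y
    using assms(1) by (simp add: finite_markov_chain.rate_nonneg)
  note conn = assms(5) and b = assms(3) and n = assms(4) and cont = assms(6)
  have card_compl: "card (- B) = n - b" by (simp add: b n Compl_eq_Diff_UNIV card_Diff_subset)
  have bn: "b < n" unfolding b n using assms(2) by (intro psubset_card_mono) auto
  define \<chi>\<^sub>D where "\<chi>\<^sub>D = char_poly (dirichlet_block p B)"
  define \<chi>\<^sub>T where "\<chi>\<^sub>T = char_poly (op_mat B (steklov p B))"
  define \<chi> where "\<chi> r = char_poly (op_mat UNIV (scaled_laplacian p B r))" for r
  have op_mat: "op_mat A T \<in> carrier_mat (card A) (card A)" for A :: "'v set" and T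
    by (simp add: op_mat_def)
  have D_carrier: "dirichlet_block p B \<in> carrier_mat (n - b) (n - b)"
    using op_mat[of "- B"] by (simp add: dirichlet_block_def card_compl)
  have \<chi>\<^sub>D: "degree \<chi>\<^sub>D = n - b" "lead_coeff \<chi>\<^sub>D = 1"
    using degree_monic_char_poly[OF D_carrier] by (auto simp: \<chi>\<^sub>D_def)
  have \<chi>\<^sub>T: "degree \<chi>\<^sub>T = b" "lead_coeff \<chi>\<^sub>T = 1"
    using degree_monic_char_poly[OF op_mat[of B]] by (auto simp: \<chi>\<^sub>T_def b)
  have root_D: "Re z > 0" if "poly \<chi>\<^sub>D z = 0" for z
    using that kernel_det_dirichlet_nonzero[OF nonneg conn, of z]
    unfolding \<chi>\<^sub>D_def dirichlet_block_def poly_char_poly_op_mat laplacian_kernel_def by force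
  have spectrum: "spectrum (dirichlet_block p B) = {z. poly \<chi>\<^sub>D z = 0}"
    unfolding \<chi>\<^sub>D_def by (rule spectrum_root_char_poly[OF D_carrier])
  have fin: "finite (spectrum (dirichlet_block p B))"
    by (rule card_finite_spectrum[OF D_carrier])
  have "spectrum (dirichlet_block p B) \<noteq> {}"
    using spectrum_non_empty[OF D_carrier] bn by simp
  then have eps_pos: "\<epsilon> > 0"
    unfolding assms(8) using fin root_D by (subst Min_gr_iff) (auto simp: spectrum)
  have eps_le: "\<epsilon> \<le> Re z" if "poly \<chi>\<^sub>D z = 0" for z
    unfolding assms(8) using fin that by (intro Min_le) (auto simp: spectrum)

  have \<chi>_eq: "poly (\<chi> r) z = (\<Prod>j\<in>{1..n}. z - lam j r)" if "r > 0" for r z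
  proof -
    have "lead_coeff (\<chi> r) = 1"
      using degree_monic_char_poly[OF op_mat[of UNIV]] by (auto simp: \<chi>_def)
    then have "\<chi> r = (\<Prod>x\<in>#proots (\<chi> r). [:-x, 1:])"
      using complex_poly_decompose_multiset[of "\<chi> r"] by simp
    also have "proots (\<chi> r) = {# lam j r. j \<in># mset_set {1..n} #}"
      using assms(7)[OF that] by (simp add: eigenvalue_mset_def \<chi>_def)
    finally have "\<chi> r = (\<Prod>j\<in>{1..n}. [:- lam j r, 1:])"
      by (simp add: image_mset.compositionality comp_def prod_unfold_prod_mset)
    then show ?thesis by (simp add: poly_prod)
  qed

  \<comment> \<open>The rescaled eigenvalues converge to the zeros of \<open>w\<^sup>b \<chi>\<^sub>D(w)\<close>.\<close>
  define \<nu> where "\<nu> j r = lam j r / complex_of_real r" for j r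
  have "\<exists>m. (\<forall>j\<in>{1..n}. (\<nu> j \<longlongrightarrow> m j) at_top) \<and> monom 1 b * \<chi>\<^sub>D = (\<Prod>j\<in>{1..n}. [:- m j, 1:])"
  proof (rule continuous_roots_tendsto)
    show "continuous_on {0<..} (\<nu> j)" if "j \<in> {1..n}" for j
      unfolding \<nu>_def by (intro continuous_intros cont that) auto
    have "\<chi>\<^sub>D \<noteq> 0" using \<chi>\<^sub>D by auto
    then show "degree (monom 1 b * \<chi>\<^sub>D) = card {1..n}"
      using bn \<chi>\<^sub>D by (simp add: degree_mult_eq degree_monom_eq)
    show "lead_coeff (monom 1 b * \<chi>\<^sub>D) = 1" by (simp only: lead_coeff_mult lead_coeff_monom \<chi>\<^sub>D(2) mult_1)
    show "((\<lambda>r. \<Prod>j\<in>{1..n}. w - \<nu> j r) \<longlongrightarrow> poly (monom 1 b * \<chi>\<^sub>D) w) at_top" for w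
    proof (rule Lim_transform_eventually)
      show "((\<lambda>r. poly (\<chi> r) (complex_of_real r * w) / complex_of_real r ^ n)
          \<longlongrightarrow> poly (monom 1 b * \<chi>\<^sub>D) w) at_top"
        using char_poly_scaled_laplacian_macro_limit[of p B w]
        by (simp add: \<chi>_def \<chi>\<^sub>D_def b n poly_monom)
      show "eventually (\<lambda>r. poly (\<chi> r) (complex_of_real r * w) / complex_of_real r ^ n
          = (\<Prod>j\<in>{1..n}. w - \<nu> j r)) at_top"
        using eventually_gt_at_top[of 0]
      proof eventually_elim
        case (elim r)
        have "poly (\<chi> r) (complex_of_real r * w) = (\<Prod>j\<in>{1..n}. complex_of_real r * (w - \<nu> j r))"
          unfolding \<chi>_eq[OF elim] using elim by (intro prod.cong) (auto simp: \<nu>_def field_simps)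
        then show ?case using elim by (simp add: prod.distrib)
      qed
    qed
  qed simp
  then obtain m where m: "\<And>j. j \<in> {1..n} \<Longrightarrow> (\<nu> j \<longlongrightarrow> m j) at_top"
    and prod_m: "monom 1 b * \<chi>\<^sub>D = (\<Prod>j\<in>{1..n}. [:- m j, 1:])" by blast

  \<comment> \<open>\<open>S\<close> collects the eigenvalues of size \<open>o(r)\<close> and \<open>L\<close> those of exact order \<open>r\<close>. Since
    \<open>\<chi>\<^sub>D(0) \<noteq> 0\<close>, comparing the order of the zero \<open>0\<close> gives \<open>|S| = b\<close>.\<close>
  define S where "S = {j \<in> {1..n}. m j = 0}"
  define L where "L = {j \<in> {1..n}. m j \<noteq> 0}"
  have SL: "S \<union> L = {1..n}" "S \<inter> L = {}" "finite S" "finite L" by (auto simp: S_def L_def)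
  have \<chi>\<^sub>D_0: "poly \<chi>\<^sub>D 0 \<noteq> 0" using root_D[of 0] by auto
  have split: "monom 1 b * \<chi>\<^sub>D = monom 1 (card S) * (\<Prod>j\<in>L. [:- m j, 1:])"
  proof -
    have "(\<Prod>j\<in>S. [:- m j, 1:]) = (\<Prod>j\<in>S. monom 1 1)"
      by (rule prod.cong) (auto simp: S_def monom_altdef)
    also have "\<dots> = monom 1 (card S)" by (simp add: monom_power)
    finally show ?thesis
      unfolding prod_m SL(1)[symmetric] prod.union_disjoint[OF SL(3,4,2)] by simp
  qed
  have L_0: "poly (\<Prod>j\<in>L. [:- m j, 1:]) 0 \<noteq> 0" by (auto simp: poly_prod L_def)
  have "b = order 0 (monom 1 b * \<chi>\<^sub>D)"
    using \<chi>\<^sub>D_0 by (subst order_mult) (auto simp: order_0I)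
  also have "\<dots> = card S"
    unfolding split using L_0 by (subst order_mult) (auto simp: order_0I)
  finally have card_S: "card S = b" by simp
  then have \<chi>\<^sub>D_L: "\<chi>\<^sub>D = (\<Prod>j\<in>L. [:- m j, 1:])" using split by simp
  have "card S + card L = n" using card_Un_disjoint[of S L] SL by simp
  then have card_L: "card L = n - b" using card_S by simp
  have m_L: "poly \<chi>\<^sub>D (m j) = 0" if "j \<in> L" for j
    unfolding \<chi>\<^sub>D_L poly_prod using that SL by (intro prod_zero) auto

  \<comment> \<open>The polynomial with zeros \<open>lam j r\<close>, \<open>j \<in> S\<close>, is obtained from \<open>\<chi> r\<close> by dividing out the factors for \<open>L\<close>.
    After division by \<open>r\<close> these tend to \<open>- m j\<close>, whose product is \<open>\<chi>\<^sub>D(0)\<close>: exactly the superfluous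
    factor in the limit of \<open>\<chi> r / r\<^bsup>n - b\<^esup>\<close>.\<close>
  have "\<exists>l. (\<forall>j\<in>S. (lam j \<longlongrightarrow> l j) at_top) \<and> \<chi>\<^sub>T = (\<Prod>j\<in>S. [:- l j, 1:])"
  proof (rule continuous_roots_tendsto)
    show "continuous_on {0<..} (lam j)" if "j \<in> S" for j using cont that by (simp add: S_def)
    show "((\<lambda>r. \<Prod>j\<in>S. z - lam j r) \<longlongrightarrow> poly \<chi>\<^sub>T z) at_top" for z
    proof -
      have "((\<lambda>r. z / complex_of_real r) \<longlongrightarrow> 0) at_top"
        using tendsto_mult_right_zero[OF one_over_of_real_tendsto_0, of z] by simp
      then have "((\<lambda>r. \<Prod>j\<in>L. z / complex_of_real r - \<nu> j r) \<longlongrightarrow> (\<Prod>j\<in>L. 0 - m j)) at_top"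
        by (intro tendsto_prod tendsto_diff m) (auto simp: L_def)
      also have "(\<Prod>j\<in>L. 0 - m j) = poly \<chi>\<^sub>D 0" by (simp add: \<chi>\<^sub>D_L poly_prod)
      finally have lim_L: "((\<lambda>r. \<Prod>j\<in>L. z / complex_of_real r - \<nu> j r) \<longlongrightarrow> poly \<chi>\<^sub>D 0) at_top" .
      have "((\<lambda>r. poly (\<chi> r) z / complex_of_real r ^ (n - b)) \<longlongrightarrow> poly \<chi>\<^sub>T z * poly \<chi>\<^sub>D 0) at_top"
        using char_poly_scaled_laplacian_micro_limit[OF nonneg conn, of z]
        by (simp add: \<chi>_def \<chi>\<^sub>D_def \<chi>\<^sub>T_def card_compl)
      from tendsto_divide[OF this lim_L \<chi>\<^sub>D_0]
      have "((\<lambda>r. poly (\<chi> r) z / complex_of_real r ^ (n - b)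
          / (\<Prod>j\<in>L. z / complex_of_real r - \<nu> j r)) \<longlongrightarrow> poly \<chi>\<^sub>T z) at_top"
        using \<chi>\<^sub>D_0 by simp
      moreover have "eventually (\<lambda>r. poly (\<chi> r) z / complex_of_real r ^ (n - b)
          / (\<Prod>j\<in>L. z / complex_of_real r - \<nu> j r) = (\<Prod>j\<in>S. z - lam j r)) at_top"
        using tendsto_imp_eventually_ne[OF lim_L \<chi>\<^sub>D_0] eventually_gt_at_top[of 0]
      proof eventually_elim
        case (elim r)
        have "(\<Prod>j\<in>L. z - lam j r) = (\<Prod>j\<in>L. complex_of_real r * (z / complex_of_real r - \<nu> j r))"
          using elim by (intro prod.cong) (auto simp: \<nu>_def field_simps)
        then have "poly (\<chi> r) z = (\<Prod>j\<in>S. z - lam j r)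
            * (complex_of_real r ^ (n - b) * (\<Prod>j\<in>L. z / complex_of_real r - \<nu> j r))"
          unfolding \<chi>_eq[OF elim(2)] SL(1)[symmetric] prod.union_disjoint[OF SL(3,4,2)]
          by (simp add: prod.distrib card_L)
        then show ?case using elim by simp
      qed
      ultimately show ?thesis by (rule Lim_transform_eventually)
    qed
  qed (use SL \<chi>\<^sub>T card_S in auto)
  then obtain l where l: "\<And>j. j \<in> S \<Longrightarrow> (lam j \<longlongrightarrow> l j) at_top"
    and prod_l: "\<chi>\<^sub>T = (\<Prod>j\<in>S. [:- l j, 1:])" by blast

  \<comment> \<open>Any permutation that sends \<open>{1..b}\<close> to \<open>S\<close> and \<open>{b+1..n}\<close> to \<open>L\<close> will do.\<close>
  obtain g where g: "bij_betw g {1..b} S"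
    using finite_same_card_bij[of "{1..b}" S] card_S SL by auto
  obtain h where h: "bij_betw h {b+1..n} L"
    using finite_same_card_bij[of "{b+1..n}" L] card_L SL by auto
  define \<pi> where "\<pi> j = (if j \<in> {1..b} then g j else if j \<in> {b+1..n} then h j else j)" for j
  have \<pi>S: "bij_betw \<pi> {1..b} S"
    using g by (rule bij_betw_cong[THEN iffD1, rotated]) (simp add: \<pi>_def)
  have \<pi>L: "bij_betw \<pi> {b+1..n} L"
    using h by (rule bij_betw_cong[THEN iffD1, rotated]) (auto simp: \<pi>_def)
  have "bij_betw \<pi> ({1..b} \<union> {b+1..n}) (S \<union> L)"
    using \<pi>S \<pi>L SL(2) by (rule bij_betw_combine)
  moreover have "{1..b} \<union> {b+1..n} = {1..n}" using bn by auto
  ultimately have perm: "\<pi> permutes {1..n}"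
    unfolding SL(1) using bn by (intro bij_imp_permutes) (auto simp: \<pi>_def)

  have steklov: "{# l (\<pi> j). j \<in># mset_set {1..b} #} = eigenvalue_mset (op_mat B (steklov p B))"
  proof -
    have "{# l (\<pi> j). j \<in># mset_set {1..b} #} = image_mset l (image_mset \<pi> (mset_set {1..b}))"
      by (simp add: image_mset.compositionality comp_def)
    also have "\<dots> = image_mset l (mset_set S)"
      using \<pi>S by (simp add: image_mset_mset_set bij_betw_def)
    also have "\<dots> = proots \<chi>\<^sub>T"
      unfolding prod_l by (subst proots_prod) (auto simp: sum_unfold_sum_mset)
    finally show ?thesis by (simp add: eigenvalue_mset_def \<chi>\<^sub>T_def)
  qed

  have growth: "((\<lambda>r. 1 / r * Re (lam (\<pi> j) r)) \<longlongrightarrow> Re (m (\<pi> j))) at_top" "Re (m (\<pi> j)) \<ge> \<epsilon>"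
    if "j \<in> {b+1..n}" for j
  proof -
    have "\<pi> j \<in> L" using \<pi>L that by (auto simp: bij_betw_def)
    then show "Re (m (\<pi> j)) \<ge> \<epsilon>" using m_L eps_le by blast
    show "((\<lambda>r. 1 / r * Re (lam (\<pi> j) r)) \<longlongrightarrow> Re (m (\<pi> j))) at_top"
      using tendsto_Re[OF m[of "\<pi> j"]] \<open>\<pi> j \<in> L\<close> by (simp add: \<nu>_def L_def)
  qed
  have "Liminf at_top (\<lambda>r. ereal (1 / r * Re (lam (\<pi> j) r))) \<ge> ereal \<epsilon>" if "j \<in> {b+1..n}" for j
  proof -
    have "Liminf at_top (\<lambda>r. ereal (1 / r * Re (lam (\<pi> j) r))) = ereal (Re (m (\<pi> j)))"
      by (intro lim_imp_Liminf tendsto_ereal growth that trivial_limit_at_top_linorder)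
    then show ?thesis using growth(2)[OF that] by simp
  qed
  moreover have "filterlim (\<lambda>r. Re (lam (\<pi> j) r)) at_top at_top" if "j \<in> {b+1..n}" for j
  proof -
    have "filterlim (\<lambda>r. 1 / r * Re (lam (\<pi> j) r) * r) at_top at_top"
      by (rule filterlim_tendsto_pos_mult_at_top[OF growth(1)[OF that] _ filterlim_ident])
        (use growth(2)[OF that] eps_pos in simp)
    moreover have "eventually (\<lambda>r. 1 / r * Re (lam (\<pi> j) r) * r = Re (lam (\<pi> j) r)) at_top"
      using eventually_gt_at_top[of 0] by eventually_elim simp
    ultimately show ?thesis using filterlim_cong[OF refl refl] by force
  qed
  moreover have "(lam (\<pi> j) \<longlongrightarrow> l (\<pi> j)) at_top" if "j \<in> {1..b}" for j
    using l that \<pi>S by (auto simp: bij_betw_def)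
  ultimately show ?thesis using eps_pos perm steklov by (intro conjI exI[of _ \<pi>] exI[of _ "l \<circ> \<pi>"]) auto
qed

end
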